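(* Let $R=\Bbbk[[t^{a_1},t^{a_2},\ldots,t^{a_n}]]$ be a complete numerical semigroup ring of minimal multiplicity. Then $R$ is of maximal reduced type if and only if $a_2\geq a_n-a_1+1$, and $R$ is of minimal reduced type if and only if $a_{n-1}+a_1-1<a_n$.
   Context: $\Bbbk$ is an algebraically closed field of characteristic $0$. A numerical semigroup is a submonoid $H$ of $\mathbb N=\{0,1,2,\dots\}$ with finite complement; here $H$ is minimally generated by $a_1<a_2<\dots<a_n$, and $R=\Bbbk[[H]]=\Bbbk[[t^{a_1},\dots,t^{a_n}]]\subseteq \overline R=\Bbbk[[t]]$. As throughout the paper, $R$ is non-regular, i.e. $H\neq\mathbb N$, so $n\ge 2$. Let $\mathfrak m$ be the maximal ideal of $R$. The multiplicity of $R$ is $e(R)=a_1$ and its embedding dimension is $n$; $R$ is of minimal multiplicity if $e(R)=n$. The conductor of $R$ is $\mathfrak C=R:_{\operatorname{Frac}(R)}\overline R$. The reduced type is $s(R)=\dim_\Bbbk\frac{\mathfrak C+t^{a_1}R}{t^{a_1}R}$ and the Cohen–Macaulay type is $\operatorname{type}(R)=\dim_\Bbbk\frac{t^{a_1}R:_R\mathfrak m}{t^{a_1}R}$; one has $1\le s(R)\le\operatorname{type}(R)$. $R$ is of maximal reduced type if $s(R)=\operatorname{type}(R)$ and of minimal reduced type if $s(R)=1$.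
   Formalization: The criterion for minimal reduced type is stated for all H except H = ⟨2,3⟩, where it fails: there s(R) = 1, but a_{n-1}+a_1-1 = 3 is not less than a_n = 3; the criterion for maximal reduced type is stated for all H. *)

theory Defs
  imports
    "HOL-Computational_Algebra.Formal_Laurent_Series"
    "HOL-Algebra.Embedded_Algebras"
    "HOL-Algebra.QuotRing"
begin

section \<open>Numerical semigroups\<close>

definition numerical_semigroup :: "nat set \<Rightarrow> bool" where
  "numerical_semigroup H \<longleftrightarrow>
     0 \<in> H \<and> (\<forall>x\<in>H. \<forall>y\<in>H. x + y \<in> H) \<and> finite (- H)"

inductive_set submonoid_generated :: "nat set \<Rightarrow> nat set" for A where
  zero: "0 \<in> submonoid_generated A"
| add: "a \<in> A \<Longrightarrow> x \<in> submonoid_generated A \<Longrightarrow> a + x \<in> submonoid_generated A"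

definition minimally_generates :: "nat set \<Rightarrow> nat set \<Rightarrow> bool" where
  "minimally_generates A H \<longleftrightarrow>
     submonoid_generated A = H \<and> (\<forall>B. B \<subset> A \<longrightarrow> submonoid_generated B \<noteq> H)"


section \<open>Numerical semigroup rings\<close>

text \<open>
  All rings and modules below are subsets of the field \<open>k((t))\<close> of formal Laurent series,
  where \<open>t\<close> is \<^const>\<open>fls_X\<close>.  The ring \<open>k[[H]]\<close> consists of the power series
  whose exponents all lie in \<open>H\<close>.
\<close>

definition semigroup_ring :: "nat set \<Rightarrow> 'k::field fls ring" where
  "semigroup_ring H =
     \<lparr>carrier = fps_to_fls ` {f. \<forall>i. fps_nth f i \<noteq> 0 \<longrightarrow> i \<in> H},
      mult = (*), one = 1, zero = 0, add = (+)\<rparr>"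

text \<open>The ring \<open>k[[t]]\<close>, which is the integral closure of \<open>k[[H]]\<close>.\<close>

definition normalization_ring :: "'k::field fls set" where
  "normalization_ring = range fps_to_fls"

definition coefficient_field :: "'k::field fls set" where
  "coefficient_field = range fls_const"

definition fraction_field :: "'k::field fls set \<Rightarrow> 'k fls set" where
  "fraction_field S = {x / y |x y. x \<in> S \<and> y \<in> S \<and> y \<noteq> 0}"

text \<open>\<open>colon Q A B\<close> is \<open>A :\<^sub>Q B\<close>.\<close>

definition colon :: "'k::field fls set \<Rightarrow> 'k fls set \<Rightarrow> 'k fls set \<Rightarrow> 'k fls set" where
  "colon Q A B = {x \<in> Q. \<forall>b\<in>B. x * b \<in> A}"

definition conductor :: "'k::field fls ring \<Rightarrow> 'k fls set" where
  "conductor R = colon (fraction_field (carrier R)) (carrier R) normalization_ring"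

definition max_ideal :: "'k::field fls ring \<Rightarrow> 'k fls set" where
  "max_ideal R = (THE M. maximalideal M R)"

text \<open>
  The dimension over \<open>k\<close> of \<open>E/I\<close>, for an ideal \<open>I\<close> of \<open>R\<close> and a \<open>k\<close>-subspace \<open>E\<close> of \<open>R\<close>
  containing \<open>I\<close>: it is taken inside the \<open>k\<close>-algebra \<open>R/I\<close>, where \<open>k\<close> is embedded as the
  cosets of the constants.
\<close>

definition quotient_dim :: "'k::field fls ring \<Rightarrow> 'k fls set \<Rightarrow> 'k fls set \<Rightarrow> nat" where
  "quotient_dim R E I =
     ring.dim (R Quot I) ((+>\<^bsub>R\<^esub>) I ` coefficient_field) ((+>\<^bsub>R\<^esub>) I ` E)"

text \<open>In the following definitions \<open>e\<close> stands for the multiplicity of the semigroup.\<close>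

definition reduced_type :: "'k::field fls ring \<Rightarrow> nat \<Rightarrow> nat" where
  "reduced_type R e =
     (let I = PIdl\<^bsub>R\<^esub> (fls_X ^ e) in quotient_dim R (conductor R <+>\<^bsub>R\<^esub> I) I)"

definition cm_type :: "'k::field fls ring \<Rightarrow> nat \<Rightarrow> nat" where
  "cm_type R e =
     (let I = PIdl\<^bsub>R\<^esub> (fls_X ^ e) in quotient_dim R (colon (carrier R) I (max_ideal R)) I)"

definition maximal_reduced_type :: "'k::field fls ring \<Rightarrow> nat \<Rightarrow> bool" where
  "maximal_reduced_type R e \<longleftrightarrow> reduced_type R e = cm_type R e"

definition minimal_reduced_type :: "'k::field fls ring \<Rightarrow> nat \<Rightarrow> bool" where
  "minimal_reduced_type R e \<longleftrightarrow> reduced_type R e = 1"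

text \<open>
  Caveat: the criterion \<open>a_{n-1} + a_1 - 1 < a_n\<close> for minimal reduced type of a ring of minimal
  multiplicity fails for exactly one semigroup, \<open>H = \<langle>2, 3\<rangle>\<close>.  There the conductor is
  \<open>t^2 k[[t]]\<close> and its image in \<open>R / t^2 R\<close> is spanned by the class of \<open>t^3\<close>, so the reduced
  type is \<open>1\<close>, whereas \<open>a_{n-1} + a_1 - 1 = 2 + 2 - 1 = 3 = a_n\<close>.  This semigroup has to be
  left out of that criterion.
\<close>

end

theory Submission
  imports Defs
begin

text \<open>
  Every ideal involved is monomial, so lengths of quotients count exponents.  With \<open>e = a 1\<close>, the
  monomials with exponents in the Apery set of \<open>e\<close> form a basis of \<open>R / t^e R\<close>; the reduced type
  counts the Apery elements at or above the conductor of \<open>H\<close>, and the type counts those which every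
  nonzero element of \<open>H\<close> moves out of the Apery set.  Under minimal multiplicity the Apery set is
  \<open>{0, a 2, \<dots>, a n}\<close>, hence the conductor is \<open>a n - n + 1\<close>; and a sum of two nonzero elements of
  \<open>H\<close>, not being a minimal generator, lies in \<open>e + H\<close>, so that the type is \<open>n - 1\<close>.
\<close>

section \<open>Power series with prescribed support\<close>

text \<open>Encodes ideals by exponent sets: \<open>R\<close>, its maximal ideal, the conductor and
  \<open>t^e R\<close> all have this shape.\<close>

definition series_on :: "nat set \<Rightarrow> 'k::field fls set" where
  "series_on A = fps_to_fls ` {f. \<forall>i. fps_nth f i \<noteq> 0 \<longrightarrow> i \<in> A}"

lemma fps_to_fls_in_series_on_iff:
  "fps_to_fls f \<in> series_on A \<longleftrightarrow> (\<forall>i. fps_nth f i \<noteq> 0 \<longrightarrow> i \<in> A)"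
  by (auto simp: series_on_def)

lemma series_onE:
  assumes "x \<in> series_on A"
  obtains f where "x = fps_to_fls f" "\<And>i. fps_nth f i \<noteq> 0 \<Longrightarrow> i \<in> A"
  using assms by (auto simp: series_on_def)

lemma series_on_mono: "A \<subseteq> B \<Longrightarrow> series_on A \<subseteq> series_on B"
  by (auto simp: series_on_def)

lemma zero_in_series_on [simp]: "0 \<in> series_on A"
  using fps_to_fls_in_series_on_iff[of 0 A] by simp

lemma one_in_series_on_iff [simp]: "1 \<in> series_on A \<longleftrightarrow> 0 \<in> A"
  using fps_to_fls_in_series_on_iff[of 1 A] by (auto split: if_splits)

lemma fls_const_in_series_on: "0 \<in> A \<Longrightarrow> fls_const c \<in> series_on A"
  using fps_to_fls_in_series_on_iff[of "fps_const c" A] by (simp flip: fps_const_to_fls)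

lemma fls_X_power_eq: "fls_X ^ n = fps_to_fls (fps_X ^ n)"
  by (metis fps_to_fls_power fps_X_to_fls)

lemma fls_X_power_in_series_on_iff [simp]: "fls_X ^ n \<in> series_on A \<longleftrightarrow> n \<in> A"
  unfolding fls_X_power_eq fps_to_fls_in_series_on_iff by (auto simp: fps_X_power_nth)

lemma series_on_add: "x \<in> series_on A \<Longrightarrow> y \<in> series_on A \<Longrightarrow> x + y \<in> series_on A"
  by (elim series_onE)
     (simp del: fps_to_fls_plus add: fps_to_fls_plus[symmetric] fps_to_fls_in_series_on_iff,
      metis add.right_neutral)

lemma series_on_uminus: "x \<in> series_on A \<Longrightarrow> - x \<in> series_on A"
  by (elim series_onE)
     (simp del: fps_to_fls_uminus add: fps_to_fls_uminus[symmetric] fps_to_fls_in_series_on_iff)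

text \<open>A nonzero coefficient of the product forces a nonzero term in its Cauchy sum.\<close>

lemma series_on_mult:
  assumes x: "x \<in> series_on A" and y: "y \<in> series_on B"
    and closed: "\<And>i j. i \<in> A \<Longrightarrow> j \<in> B \<Longrightarrow> i + j \<in> C"
  shows "x * y \<in> series_on C"
proof -
  obtain f where f: "x = fps_to_fls f" "\<And>i. fps_nth f i \<noteq> 0 \<Longrightarrow> i \<in> A"
    using x by (rule series_onE) blast
  obtain g where g: "y = fps_to_fls g" "\<And>i. fps_nth g i \<noteq> 0 \<Longrightarrow> i \<in> B"
    using y by (rule series_onE) blast
  have "i \<in> C" if "fps_nth (f * g) i \<noteq> 0" for i
  proof -
    have "(\<Sum>j=0..i. fps_nth f j * fps_nth g (i - j)) \<noteq> 0"
      using that by (simp add: fps_mult_nth)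
    then obtain j where "j \<in> {0..i}" "fps_nth f j * fps_nth g (i - j) \<noteq> 0"
      by (rule sum.not_neutral_contains_not_neutral)
    then show ?thesis
      using f(2)[of j] g(2)[of "i - j"] closed[of j "i - j"] by auto
  qed
  then show ?thesis
    by (simp add: f g fps_to_fls_in_series_on_iff fls_times_fps_to_fls[symmetric])
qed

lemma series_on_Un_split:
  assumes "x \<in> series_on (A \<union> B)"
  obtains y z where "y \<in> series_on A" "z \<in> series_on B" "x = y + z"
proof -
  obtain f where f: "x = fps_to_fls f" "\<And>i. fps_nth f i \<noteq> 0 \<Longrightarrow> i \<in> A \<union> B"
    using assms by (rule series_onE) blast
  \<comment> \<open>Exponents in both sets go to \<open>A\<close>, so the remainder
    \<open>f - g\<close> is supported in \<open>B\<close>.\<close>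
  define g where "g = Abs_fps (\<lambda>i. if i \<in> A then fps_nth f i else 0)"
  show ?thesis
  proof
    show "fps_to_fls g \<in> series_on A"
      by (auto simp: fps_to_fls_in_series_on_iff g_def)
    show "fps_to_fls (f - g) \<in> series_on B"
      using f(2) by (auto simp del: fps_to_fls_minus simp: fps_to_fls_in_series_on_iff g_def)
    show "x = fps_to_fls g + fps_to_fls (f - g)"
      by (simp add: f(1))
  qed
qed

lemma series_on_shift_iff:
  "x \<in> series_on ((+) e ` A) \<longleftrightarrow> (\<exists>y\<in>series_on A. x = y * fls_X ^ e)"
proof
  assume "x \<in> series_on ((+) e ` A)"
  then obtain f where f: "x = fps_to_fls f" "\<And>i. fps_nth f i \<noteq> 0 \<Longrightarrow> i \<in> (+) e ` A"
    by (rule series_onE) blast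
  \<comment> \<open>All exponents of \<open>f\<close> are at least \<open>e\<close>, so shifting
    down by \<open>e\<close> loses nothing.\<close>
  have "fps_nth f i = fps_nth (fps_shift e f * fps_X ^ e) i" for i
    using f(2)[of i] by (auto simp: fps_X_power_mult_right_nth)
  then have "f = fps_shift e f * fps_X ^ e"
    by (rule fps_ext)
  then have "x = fps_to_fls (fps_shift e f) * fls_X ^ e"
    by (metis f(1) fls_X_power_eq fls_times_fps_to_fls)
  moreover have "fps_to_fls (fps_shift e f) \<in> series_on A"
    unfolding fps_to_fls_in_series_on_iff using f(2) by force
  ultimately show "\<exists>y\<in>series_on A. x = y * fls_X ^ e"
    by blast
next
  assume "\<exists>y\<in>series_on A. x = y * fls_X ^ e"
  then show "x \<in> series_on ((+) e ` A)"
    by (auto intro!: series_on_mult[of _ A _ "{e}"])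
qed

text \<open>Multiplication by a monomial \<open>t^j\<close> shifts the support without cancellation,
  so testing against monomials already gives the condition on exponents.\<close>

lemma series_on_colon:
  "colon (series_on A) (series_on B) (series_on C) = series_on {i \<in> A. \<forall>j\<in>C. i + j \<in> B}"
proof (intro Set.set_eqI iffI)
  fix x :: "'a fls"
  assume "x \<in> colon (series_on A) (series_on B) (series_on C)"
  then have x: "x \<in> series_on A" and mult: "\<And>y. y \<in> series_on C \<Longrightarrow> x * y \<in> series_on B"
    by (auto simp: colon_def)
  obtain f where f: "x = fps_to_fls f" "\<And>i. fps_nth f i \<noteq> 0 \<Longrightarrow> i \<in> A"
    using x by (rule series_onE) blast
  have "i + j \<in> B" if "fps_nth f i \<noteq> 0" "j \<in> C" for i j
  proof -
    have "x * fls_X ^ j \<in> series_on B"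
      using mult that by simp
    then have "fps_to_fls (f * fps_X ^ j) \<in> series_on B"
      by (simp add: f(1) fls_X_power_eq fls_times_fps_to_fls)
    then show ?thesis
      using that by (simp add: fps_to_fls_in_series_on_iff fps_X_power_mult_right_nth)
  qed
  then show "x \<in> series_on {i \<in> A. \<forall>j\<in>C. i + j \<in> B}"
    using f by (auto simp: fps_to_fls_in_series_on_iff)
next
  fix x :: "'a fls"
  assume x: "x \<in> series_on {i \<in> A. \<forall>j\<in>C. i + j \<in> B}"
  then have "x \<in> series_on A"
    using series_on_mono[of "{i \<in> A. \<forall>j\<in>C. i + j \<in> B}" A] by auto
  with x show "x \<in> colon (series_on A) (series_on B) (series_on C)"
    by (auto simp: colon_def intro: series_on_mult)
qed

lemma normalization_ring_eq: "normalization_ring = series_on UNIV"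
  by (auto simp: normalization_ring_def series_on_def)

lemma inverse_in_series_on:
  fixes f :: "'k::field fps"
  assumes f: "fps_to_fls f \<in> series_on H" and f0: "fps_nth f 0 \<noteq> 0"
    and zero: "0 \<in> H" and closed: "\<And>i j. i \<in> H \<Longrightarrow> j \<in> H \<Longrightarrow> i + j \<in> H"
  shows "fps_to_fls (inverse f) \<in> series_on H"
proof -
  have "i \<in> H" if "fps_nth (inverse f) i \<noteq> 0" for i
    using that
  proof (induction i rule: less_induct)
    case (less i)
    show ?case
    proof (cases "i = 0")
      case False
      \<comment> \<open>At \<open>i > 0\<close> the coefficient of \<open>f * inverse f = 1\<close>
        vanishes, which expresses coefficient \<open>i\<close> of the inverse through earlier
        ones.\<close>
      have "(\<Sum>j=0..i. fps_nth f j * fps_nth (inverse f) (i - j)) = 0"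
        using False inverse_mult_eq_1'[OF f0] by (simp flip: fps_mult_nth)
      then have "fps_nth f 0 * fps_nth (inverse f) i
          + (\<Sum>j\<in>{0<..i}. fps_nth f j * fps_nth (inverse f) (i - j)) = 0"
        by (subst (asm) sum.head) auto
      then have "(\<Sum>j\<in>{0<..i}. fps_nth f j * fps_nth (inverse f) (i - j)) \<noteq> 0"
        using less.prems f0 by auto
      then obtain j where j: "j \<in> {0<..i}" "fps_nth f j * fps_nth (inverse f) (i - j) \<noteq> 0"
        by (rule sum.not_neutral_contains_not_neutral)
      then have "j \<in> H" "i - j \<in> H"
        using f less.IH[of "i - j"] by (auto simp: fps_to_fls_in_series_on_iff)
      then show ?thesis
        using closed[of j "i - j"] j by simp
    qed (simp add: zero)
  qed
  then show ?thesis
    by (simp add: fps_to_fls_in_series_on_iff)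
qed


section \<open>Invariants of a numerical semigroup ring\<close>

locale numerical_semigroup_ring =
  fixes H :: "nat set" and R :: "'k::field fls ring" (structure)
  assumes semigroup: "numerical_semigroup H" and R_eq: "R = semigroup_ring H"
begin

section \<open>Ring structure, maximal ideal and conductor\<close>

lemma zero_in_H: "0 \<in> H" and add_in_H: "x \<in> H \<Longrightarrow> y \<in> H \<Longrightarrow> x + y \<in> H"
  and finite_gaps: "finite (- H)"
  using semigroup by (auto simp: numerical_semigroup_def)

lemma R_simps [simp]: "carrier R = series_on H" "mult R = (*)" "one R = 1" "zero R = 0" "add R = (+)"
  by (simp_all add: R_eq semigroup_ring_def series_on_def)

sublocale cring R
proof (rule cringI)
  show "abelian_group R"
    by (rule abelian_groupI)
       (auto simp: add_ac series_on_add intro!: exI bexI[OF _ series_on_uminus])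
  show "comm_monoid R"
    by (rule comm_monoidI)
       (auto simp: mult_ac zero_in_H intro: series_on_mult add_in_H)
qed (simp add: algebra_simps)

lemma a_minus_eq: "x \<in> carrier R \<Longrightarrow> \<ominus> x = - x"
  by (rule minus_equality) (auto intro: series_on_uminus)

lemma ideal_series_on:
  assumes "J \<subseteq> H" and "\<And>x y. x \<in> J \<Longrightarrow> y \<in> H \<Longrightarrow> x + y \<in> J"
  shows "ideal (series_on J) R"
proof (rule idealI)
  have sub: "series_on J \<subseteq> carrier R"
    using series_on_mono[OF assms(1)] by auto
  have "\<ominus> x \<in> series_on J" if "x \<in> series_on J" for x
    using that sub a_minus_eq[of x] by (auto simp: series_on_uminus)
  then show "subgroup (series_on J) (add_monoid R)"
    using sub by (intro add.subgroupI) (auto intro: series_on_add zero_in_series_on)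
  show "a \<otimes> x \<in> series_on J" "x \<otimes> a \<in> series_on J"
    if "a \<in> series_on J" "x \<in> carrier R" for a x
    using that series_on_mult[of a J x H J] assms(2) by (auto simp: mult.commute)
qed (rule ring_axioms)

text \<open>\<open>R\<close> is local: a series with nonzero constant term has its inverse in
  \<open>R\<close>, so proper ideals contain no such series. The resulting uniqueness resolves the
  \<open>THE\<close> in \<open>max_ideal\<close>.\<close>

lemma max_ideal_eq: "max_ideal R = series_on (H - {0})"
proof -
  let ?M = "series_on (H - {0}) :: 'k fls set"
  have ideal: "ideal ?M R"
    by (rule ideal_series_on) (auto intro: add_in_H)
  have proper: "J \<subseteq> ?M" if J: "ideal J R" "J \<noteq> carrier R" for J
  proof
    fix x assume x: "x \<in> J"
    interpret J: ideal J R by fact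
    have "x \<in> series_on H"
      using x J.a_subset by auto
    then obtain f where f: "x = fps_to_fls f" "\<And>i. fps_nth f i \<noteq> 0 \<Longrightarrow> i \<in> H"
      by (rule series_onE) blast
    have "fps_nth f 0 = 0"
    proof (rule ccontr)
      assume f0: "fps_nth f 0 \<noteq> 0"
      have "fps_to_fls (inverse f) \<in> series_on H"
        by (rule inverse_in_series_on[OF _ f0])
           (auto simp: fps_to_fls_in_series_on_iff f(2) zero_in_H add_in_H)
      then have "x \<otimes> fps_to_fls (inverse f) \<in> J"
        by (intro J.I_r_closed) (use x in auto)
      then have "1 \<in> J"
        by (simp add: f(1) inverse_mult_eq_1'[OF f0] flip: fls_times_fps_to_fls)
      with J.one_imp_carrier J(2) show False
        by simp
    qed
    then show "x \<in> ?M"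
      using f by (auto simp: fps_to_fls_in_series_on_iff intro!: gr0I)
  qed
  have maximal: "maximalideal ?M R"
  proof (rule maximalidealI[OF ideal])
    have "1 \<in> carrier R" "1 \<notin> ?M"
      by (simp_all add: zero_in_H)
    then show "carrier R \<noteq> ?M"
      by blast
  qed (use proper in blast)
  have "M = ?M" if "maximalideal M R" for M
  proof -
    interpret M: maximalideal M R by fact
    have "M \<subseteq> ?M"
      using proper[OF M.is_ideal] M.I_notcarr by metis
    moreover have "?M \<subseteq> carrier R"
      using series_on_mono[of "H - {0}" H] by auto
    ultimately have "?M = M \<or> ?M = carrier R"
      using M.I_maximal[OF ideal] by blast
    then show ?thesis
      using maximalideal.I_notcarr[OF maximal] by blast
  qed
  with maximal show ?thesis
    unfolding max_ideal_def by (rule the_equality)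
qed

text \<open>Since \<open>1\<close> lies in \<open>k[[t]]\<close>, the colon taken in the fraction
  field is already contained in \<open>R\<close> and can be read off exponentwise.\<close>

lemma conductor_eq: "conductor R = series_on {m. {m..} \<subseteq> H}"
proof -
  have "colon (fraction_field (carrier R)) (carrier R) normalization_ring
      = colon (carrier R) (carrier R) (normalization_ring :: 'k fls set)"
  proof -
    have "x \<in> fraction_field (carrier R)" if "x \<in> carrier R" for x
      unfolding fraction_field_def using that zero_in_H
      by (intro CollectI exI[of _ x] exI[of _ 1]) auto
    moreover have "x \<in> carrier R" if "\<forall>b\<in>normalization_ring. x * b \<in> carrier R" for x
      using bspec[OF that, of 1] by (simp add: normalization_ring_eq)
    ultimately show ?thesis
      by (auto simp: colon_def)
  qed
  also have "\<dots> = series_on {i \<in> H. \<forall>j\<in>UNIV. i + j \<in> H}"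
    by (simp add: normalization_ring_eq series_on_colon)
  also have "{i \<in> H. \<forall>j\<in>UNIV. i + j \<in> H} = {m. {m..} \<subseteq> H}"
    by (auto simp: subset_iff le_iff_add)
  finally show ?thesis
    by (simp add: conductor_def)
qed

lemma principal_ideal_eq: "PIdl (fls_X ^ e) = series_on ((+) e ` H)"
  by (auto simp: cgenideal_def series_on_shift_iff)

section \<open>Scalars and dimensions of monomial quotients\<close>

lemma coefficient_subfield: "subfield coefficient_field R"
proof (rule subfieldI)
  show "subcring coefficient_field R"
  proof (rule subcringI, rule subringI)
    show "coefficient_field \<subseteq> carrier R"
      by (auto simp: coefficient_field_def fls_const_in_series_on zero_in_H)
    show "\<one> \<in> coefficient_field"
      by (auto simp: coefficient_field_def intro!: image_eqI[of _ _ 1])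
    show "\<ominus> h \<in> coefficient_field" if "h \<in> coefficient_field" for h
      using that a_minus_eq[of h]
      by (auto simp: coefficient_field_def fls_const_in_series_on zero_in_H
               simp flip: fls_const_uminus)
  qed (auto simp: coefficient_field_def fls_plus_const mult.commute)
  show "Units (R\<lparr>carrier := coefficient_field\<rparr>) = coefficient_field - {\<zero>}"
  proof (intro equalityI subsetI)
    fix x :: "'k fls" assume "x \<in> coefficient_field - {\<zero>}"
    then obtain c where c: "x = fls_const c" "c \<noteq> 0"
      by (auto simp: coefficient_field_def)
    then show "x \<in> Units (R\<lparr>carrier := coefficient_field\<rparr>)"
      by (auto simp: Units_def coefficient_field_def intro: exI[of _ "inverse c"])
  qed (auto simp: Units_def coefficient_field_def)
qed

text \<open>The classes of \<open>t^w\<close> for \<open>w\<close> in \<open>B - J\<close> form a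
  basis. Exponents are adjoined one at a time, each raising the dimension by one.\<close>

lemma quotient_dim_series_on:
  assumes "J \<subseteq> B" "B \<subseteq> H" "finite (B - J)" "0 \<notin> J"
    and closed: "\<And>x y. x \<in> J \<Longrightarrow> y \<in> H \<Longrightarrow> x + y \<in> J"
  shows "quotient_dim R (series_on B) (series_on J) = card (B - J)"
proof -
  let ?I = "series_on J :: 'k fls set"
  let ?q = "(+>) ?I" and ?K = "coefficient_field :: 'k fls set"
  interpret I: ideal ?I R
    using assms by (intro ideal_series_on) auto
  interpret Q: cring "R Quot ?I"
    by (rule I.quotient_is_cring[OF is_cring])
  interpret q: ring_hom_ring R "R Quot ?I" ?q
    by (rule I.rcos_ring_hom_ring)
  have sub: "series_on (J \<union> D) \<subseteq> carrier R" if "D \<subseteq> B - J" for D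
    using series_on_mono[of "J \<union> D" H] that assms(1,2) by auto
  have coset_eq: "?q x = ?I \<longleftrightarrow> x \<in> ?I" if "x \<in> carrier R" for x
    using that I.a_rcos_const I.rcos_const_imp_mem by blast
  \<comment> \<open>\<open>0 \<notin> J\<close> keeps \<open>1\<close> out of the ideal, so the
    quotient is nonzero and the constants map onto a subfield of it.\<close>
  have "\<one>\<^bsub>R Quot ?I\<^esub> \<noteq> \<zero>\<^bsub>R Quot ?I\<^esub>"
    using coset_eq[of 1] assms(4) zero_in_H by (simp add: FactRing_def)
  then have K: "subfield (?q ` ?K) (R Quot ?I)"
    by (rule q.img_is_subfield(2)[OF coefficient_subfield])
  have dim: "Q.dimension (card D) (?q ` ?K) (?q ` series_on (J \<union> D))"
    if "finite D" "D \<subseteq> B - J" for D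
    using that
  proof (induction D rule: finite_induct)
    case empty
    have "?q ` ?I = {?I}"
      using I.a_rcos_const zero_in_series_on by blast
    then show ?case
      using Q.zero_dim[of "?q ` ?K"] by (simp add: FactRing_def)
  next
    case (insert w D)
    define E where "E = (series_on (J \<union> D) :: 'k fls set)"
    have w: "fls_X ^ w \<in> carrier R"
      using insert.prems assms(2) by auto
    have E: "E \<subseteq> carrier R"
      using sub insert.prems by (simp add: E_def)
    have K_sub: "?K \<subseteq> carrier R"
      using subfieldE(3)[OF coefficient_subfield] .
    \<comment> \<open>\<open>E\<close> contains the ideal, so a class already present would put
      \<open>t^w\<close> itself into \<open>E\<close>, although \<open>w\<close> is outside
      \<open>J \<union> D\<close>.\<close>
    have "?q (fls_X ^ w) \<notin> ?q ` E"
    proof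
      assume "?q (fls_X ^ w) \<in> ?q ` E"
      then obtain u where u: "u \<in> E" "?q (fls_X ^ w) = ?q u"
        by blast
      have "fls_X ^ w \<in> ?q u"
        using I.a_rcos_self[OF w] u(2) by simp
      then obtain i where i: "i \<in> ?I" "fls_X ^ w = i + u"
        by (auto simp: a_r_coset_def')
      have "i \<in> E"
        using i(1) series_on_mono[of J "J \<union> D"] by (auto simp: E_def)
      with u(1) i(2) have "fls_X ^ w \<in> E"
        by (simp add: E_def series_on_add)
      then show False
        using insert by (simp add: E_def)
    qed
    then have "Q.dimension (Suc (card D)) (?q ` ?K)
        (Q.line_extension (?q ` ?K) (?q (fls_X ^ w)) (?q ` E))"
      using insert w by (intro Q.Suc_dim) (auto simp: E_def)
    also have "Q.line_extension (?q ` ?K) (?q (fls_X ^ w)) (?q ` E)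
        = ?q ` series_on (J \<union> insert w D)"
    proof -
      have hom: "?q k \<otimes>\<^bsub>R Quot ?I\<^esub> ?q (fls_X ^ w) \<oplus>\<^bsub>R Quot ?I\<^esub> ?q v = ?q (k * fls_X ^ w + v)"
        if "k \<in> ?K" "v \<in> E" for k v
      proof -
        have "k \<in> carrier R" "v \<in> carrier R"
          using that K_sub E by auto
        then show ?thesis
          using w q.hom_mult q.hom_add m_closed by (metis R_simps(2,5))
      qed
      \<comment> \<open>Splitting off the term at \<open>w\<close> identifies the line extension
        with the image of the enlarged space.\<close>
      have in_iff: "x \<in> series_on (J \<union> insert w D) \<longleftrightarrow> (\<exists>k\<in>?K. \<exists>v\<in>E. x = k * fls_X ^ w + v)"
        for x
      proof
        assume "x \<in> series_on (J \<union> insert w D)"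
        then obtain y z where yz: "y \<in> series_on {w}" "z \<in> E" "x = y + z"
          using series_on_Un_split[of x "{w}" "J \<union> D"] by (auto simp: E_def)
        have "y \<in> series_on ((+) w ` {0})"
          using yz(1) by simp
        then obtain k where k: "k \<in> series_on {0}" "y = k * fls_X ^ w"
          unfolding series_on_shift_iff by blast
        obtain f where f: "k = fps_to_fls f" "\<And>i. fps_nth f i \<noteq> 0 \<Longrightarrow> i \<in> {0}"
          using k(1) by (rule series_onE) blast
        have "f = fps_const (fps_nth f 0)"
          by (rule fps_ext) (use f(2) in \<open>auto simp: fps_nth_fps_const\<close>)
        then have "k = fls_const (fps_nth f 0)"
          by (metis f(1) fps_const_to_fls)
        then show "\<exists>k\<in>?K. \<exists>v\<in>E. x = k * fls_X ^ w + v"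
          using yz k by (auto simp: coefficient_field_def)
      next
        assume "\<exists>k\<in>?K. \<exists>v\<in>E. x = k * fls_X ^ w + v"
        then obtain c v where x: "x = fls_const c * fls_X ^ w + v" "v \<in> E"
          by (auto simp: coefficient_field_def)
        have "fls_const c * fls_X ^ w \<in> series_on (J \<union> insert w D)"
          by (rule series_on_mult[of _ "{0}" _ "{w}"]) (auto intro: fls_const_in_series_on)
        moreover have "v \<in> series_on (J \<union> insert w D)"
          using x(2) series_on_mono[of "J \<union> D" "J \<union> insert w D"] by (auto simp: E_def)
        ultimately show "x \<in> series_on (J \<union> insert w D)"
          by (simp add: x(1) series_on_add)
      qed
      show ?thesis
      proof (rule Set.set_eqI)
        fix Y
        have "Y \<in> Q.line_extension (?q ` ?K) (?q (fls_X ^ w)) (?q ` E)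
            \<longleftrightarrow> (\<exists>k\<in>?K. \<exists>v\<in>E. Y = ?q (k * fls_X ^ w + v))"
          by (simp add: Q.line_extension_mem_iff hom cong: bex_cong)
        also have "\<dots> \<longleftrightarrow> Y \<in> ?q ` series_on (J \<union> insert w D)"
          unfolding image_iff Bex_def[of "series_on _"] in_iff by blast
        finally show "Y \<in> Q.line_extension (?q ` ?K) (?q (fls_X ^ w)) (?q ` E)
            \<longleftrightarrow> Y \<in> ?q ` series_on (J \<union> insert w D)" .
      qed
    qed
    finally show ?case
      using insert by simp
  qed
  have "J \<union> (B - J) = B"
    using assms(1) by blast
  then show ?thesis
    using Q.dimI[OF K dim[of "B - J"]] assms(3) by (simp add: quotient_dim_def over_def)
qed

section \<open>Apery sets and the two types\<close>

text \<open>For a positive \<open>e\<close> in \<open>H\<close> these are the least elements of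
  \<open>H\<close> in the residue classes modulo \<open>e\<close>.\<close>

definition apery :: "nat \<Rightarrow> nat set" where
  "apery e = H - (+) e ` H"

text \<open>An Apery element \<open>w \<ge> e\<close> comes from the gap \<open>w - e\<close>, and
  there are finitely many gaps.\<close>

lemma finite_apery: "finite (apery e)"
proof (rule finite_subset)
  show "apery e \<subseteq> {..<e} \<union> (+) e ` (- H)"
    unfolding apery_def
    by (safe, metis ComplI image_eqI le_add_diff_inverse lessThan_iff not_less)
qed (simp add: finite_gaps)

context
  fixes e :: nat
  assumes e: "e \<in> H" "0 < e"
begin

lemma quotient_dim_principal:
  assumes "(+) e ` H \<subseteq> B" "B \<subseteq> H"
  shows "quotient_dim R (series_on B) (PIdl (fls_X ^ e)) = card (B \<inter> apery e)"
proof -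
  have "B - (+) e ` H = B \<inter> apery e"
    using assms by (auto simp: apery_def)
  moreover have "x + y \<in> (+) e ` H" if "x \<in> (+) e ` H" "y \<in> H" for x y
    using that by (auto simp: add.assoc add_in_H)
  ultimately show ?thesis
    unfolding principal_ideal_eq
    using assms e finite_apery by (subst quotient_dim_series_on) auto
qed

lemma shift_subset_H: "(+) e ` H \<subseteq> H"
  using e add_in_H by auto

text \<open>A sum of monomial ideals has the union of their exponent sets, and the part
  \<open>e + H\<close> misses the Apery set.\<close>

lemma reduced_type_eq: "reduced_type R e = card {w \<in> apery e. {w..} \<subseteq> H}"
proof -
  define B where "B = {m. {m..} \<subseteq> H} \<union> (+) e ` H"
  have "conductor R <+>\<^bsub>R\<^esub> PIdl (fls_X ^ e) = series_on B"
  proof (intro Set.set_eqI iffI)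
    fix x assume "x \<in> conductor R <+>\<^bsub>R\<^esub> PIdl (fls_X ^ e)"
    then obtain y z where "x = y + z" "y \<in> series_on {m. {m..} \<subseteq> H}" "z \<in> series_on ((+) e ` H)"
      by (auto simp: set_add_def' conductor_eq principal_ideal_eq)
    then show "x \<in> series_on B"
      using series_on_mono[of "{m. {m..} \<subseteq> H}" B] series_on_mono[of "(+) e ` H" B]
      by (auto simp: B_def intro!: series_on_add)
  next
    fix x assume "x \<in> (series_on B :: 'k fls set)"
    then show "x \<in> conductor R <+>\<^bsub>R\<^esub> PIdl (fls_X ^ e)"
      unfolding B_def set_add_def' conductor_eq principal_ideal_eq
      by (elim series_on_Un_split) auto
  qed
  moreover have "B \<subseteq> H" "(+) e ` H \<subseteq> B"
    using shift_subset_H by (auto simp: B_def)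
  moreover have "B \<inter> apery e = {w \<in> apery e. {w..} \<subseteq> H}"
    by (auto simp: B_def apery_def)
  ultimately show ?thesis
    using quotient_dim_principal[of B] by (simp add: reduced_type_def Let_def)
qed

text \<open>The colon ideal modulo \<open>t^e R\<close> is the socle of the quotient;
  \<open>series_on_colon\<close> yields its exponents.\<close>

lemma cm_type_eq: "cm_type R e = card {w \<in> apery e. \<forall>y\<in>H - {0}. w + y \<in> (+) e ` H}"
proof -
  define B where "B = {x \<in> H. \<forall>y\<in>H - {0}. x + y \<in> (+) e ` H}"
  have "colon (carrier R) (PIdl (fls_X ^ e)) (max_ideal R) = series_on B"
    by (simp add: max_ideal_eq principal_ideal_eq series_on_colon B_def)
  moreover have "B \<subseteq> H"
    by (auto simp: B_def)
  moreover have "(+) e ` H \<subseteq> B"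
    using shift_subset_H by (auto simp: B_def add.assoc add_in_H)
  moreover have "B \<inter> apery e = {w \<in> apery e. \<forall>y\<in>H - {0}. w + y \<in> (+) e ` H}"
    by (auto simp: B_def apery_def)
  ultimately show ?thesis
    using quotient_dim_principal[of B] by (simp add: cm_type_def Let_def)
qed

end

end


section \<open>The Apery set under minimal multiplicity\<close>

lemma submonoid_generated_incl: "x \<in> A \<Longrightarrow> x \<in> submonoid_generated A"
  using submonoid_generated.add[OF _ submonoid_generated.zero] by fastforce

lemma submonoid_generated_add:
  assumes "x \<in> submonoid_generated A" "y \<in> submonoid_generated A"
  shows "x + y \<in> submonoid_generated A"
  using assms(1)
  by induction (auto simp: assms(2) add.assoc intro: submonoid_generated.add)

lemma submonoid_generated_least:
  assumes "A \<subseteq> submonoid_generated B"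
  shows "submonoid_generated A \<subseteq> submonoid_generated B"
proof
  fix x assume "x \<in> submonoid_generated A"
  then show "x \<in> submonoid_generated B"
    by induction (use assms in \<open>auto intro: submonoid_generated.zero submonoid_generated_add\<close>)
qed

text \<open>The summands \<open>y\<close> and \<open>z\<close> are smaller than \<open>x\<close>, so
  they are generated without \<open>x\<close>; then \<open>x\<close> would be redundant, contrary to
  minimality.\<close>

lemma minimal_generator_irreducible:
  assumes min: "minimally_generates A H" and x: "x \<in> A"
    and yz: "y \<in> H" "z \<in> H" "0 < y" "0 < z"
  shows "x \<noteq> y + z"
proof
  assume "x = y + z"
  have H: "submonoid_generated A = H"
    using min by (simp add: minimally_generates_def)
  have smaller: "h < x \<longrightarrow> h \<in> submonoid_generated (A - {x})" if "h \<in> submonoid_generated A" for h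
    using that by induction (auto intro: submonoid_generated.intros)
  have "y \<in> submonoid_generated (A - {x})" "z \<in> submonoid_generated (A - {x})"
    using smaller \<open>x = y + z\<close> yz H by auto
  then have "x \<in> submonoid_generated (A - {x})"
    using submonoid_generated_add \<open>x = y + z\<close> by simp
  then have "A \<subseteq> submonoid_generated (A - {x})"
    using submonoid_generated_incl[of _ "A - {x}"] by blast
  then have "submonoid_generated A \<subseteq> submonoid_generated (A - {x})"
    by (rule submonoid_generated_least)
  moreover have "submonoid_generated (A - {x}) \<subseteq> submonoid_generated A"
    by (intro submonoid_generated_least) (use submonoid_generated_incl in auto)
  ultimately have "submonoid_generated (A - {x}) = H"
    using H by simp
  moreover have "A - {x} \<subset> A"
    using x by auto
  ultimately show False
    using min by (auto simp: minimally_generates_def)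
qed

section \<open>Apery set and conductor under minimal multiplicity\<close>

text \<open>The multiplicity is \<open>a 1\<close> and the embedding dimension is \<open>n\<close>,
  whence the form of \<open>minimal_multiplicity\<close>.\<close>

locale minimal_multiplicity_semigroup_ring = numerical_semigroup_ring H R
  for H :: "nat set" and R :: "'k::field fls ring" (structure) +
  fixes n :: nat and a :: "nat \<Rightarrow> nat"
  assumes non_regular: "H \<noteq> UNIV"
    and increasing: "strict_mono_on {1..n} a"
    and generators: "minimally_generates (a ` {1..n}) H"
    and minimal_multiplicity: "a 1 = n"
begin

lemma H_eq: "H = submonoid_generated (a ` {1..n})"
  using generators by (simp add: minimally_generates_def)

text \<open>Without generators \<open>H\<close> would have infinite complement; a single generator
  would be \<open>1\<close> and give the excluded regular case.\<close>

lemma n_ge_2: "2 \<le> n"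
proof -
  have "n \<noteq> 0"
  proof
    assume "n = 0"
    have "x = 0" if "x \<in> submonoid_generated {}" for x
      using that by cases auto
    then have "H \<subseteq> {0}"
      using H_eq \<open>n = 0\<close> by auto
    then have "finite H"
      by (rule finite_subset) simp
    with finite_gaps have "finite (UNIV :: nat set)"
      by (metis Compl_partition finite_Un)
    then show False
      by simp
  qed
  moreover have "n \<noteq> 1"
  proof
    assume "n = 1"
    then have "1 \<in> H"
      using H_eq minimal_multiplicity by (simp add: submonoid_generated_incl)
    have "m \<in> H" for m
      by (induction m) (use zero_in_H add_in_H[OF \<open>1 \<in> H\<close>] in auto)
    then show False
      using non_regular by auto
  qed
  ultimately show ?thesis
    by linarith
qed

lemma a_mono: "1 \<le> i \<Longrightarrow> i < j \<Longrightarrow> j \<le> n \<Longrightarrow> a i < a j"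
  using strict_mono_onD[OF increasing, of i j] by simp

lemma a_in_H: "1 \<le> i \<Longrightarrow> i \<le> n \<Longrightarrow> a i \<in> H"
  using H_eq by (auto intro: submonoid_generated_incl)

lemma a_gt_n: "2 \<le> i \<Longrightarrow> i \<le> n \<Longrightarrow> n < a i"
  using a_mono[of 1 i] minimal_multiplicity by simp

lemma a_irreducible:
  "\<lbrakk>1 \<le> i; i \<le> n; x \<in> H; y \<in> H; 0 < x; 0 < y\<rbrakk> \<Longrightarrow> a i \<noteq> x + y"
  using minimal_generator_irreducible[OF generators] by simp

lemma a_le_a_n: "1 \<le> i \<Longrightarrow> i \<le> n \<Longrightarrow> a i \<le> a n"
  using a_mono[of i n] by (cases "i = n") auto

lemma inj_on_a: "inj_on a {1..n}"
  using increasing by (rule strict_mono_on_imp_inj_on)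

lemma n_in_H: "n \<in> H"
  using a_in_H[of 1] n_ge_2 minimal_multiplicity by simp

lemma add_multiple_in_H:
  assumes "x \<in> H"
  shows "x + n * j \<in> H"
proof (induction j)
  case (Suc j)
  then show ?case
    using add_in_H[OF n_in_H] by (simp add: add.left_commute)
qed (simp add: assms)

text \<open>Of two distinct congruent elements of \<open>H\<close>, the larger is the smaller plus a
  positive multiple of \<open>n\<close>, so it lies in \<open>n + H\<close>, outside the Apery
  set.\<close>

lemma apery_cong:
  assumes "x \<in> apery n" "y \<in> apery n" "x mod n = y mod n"
  shows "x = y"
proof -
  have *: "x = y" if xy: "x \<in> apery n" "y \<in> apery n" "x mod n = y mod n" "x \<le> y" for x y
  proof (rule ccontr)
    assume "x \<noteq> y"
    have "n dvd y - x"
      using xy by (metis mod_eq_dvd_iff_nat)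
    then obtain k where k: "y = x + n * k"
      using xy(4) by (metis dvdE le_add_diff_inverse)
    then obtain j where j: "k = Suc j"
      using \<open>x \<noteq> y\<close> by (cases k) auto
    have "x + n * j \<in> H"
      using xy(1) add_multiple_in_H by (simp add: apery_def)
    then have "y \<in> (+) n ` H"
      using k j by (intro image_eqI[of _ _ "x + n * j"]) auto
    then show False
      using xy(2) by (simp add: apery_def)
  qed
  show ?thesis
    using *[of x y] *[of y x] assms by (cases "x \<le> y") auto
qed

text \<open>The elements \<open>0, a 2, \<dots>, a n\<close> of the Apery set are \<open>n\<close> in number and pairwise
  incongruent modulo \<open>n\<close>, so they already meet every residue class.\<close>

lemma apery_eq: "apery n = insert 0 (a ` {2..n})"
  and apery_residues: "(\<lambda>w. w mod n) ` apery n = {..<n}"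
proof -
  let ?W = "insert 0 (a ` {2..n})"
  have W: "?W \<subseteq> apery n"
  proof
    fix w assume "w \<in> ?W"
    then consider "w = 0" | i where "2 \<le> i" "i \<le> n" "w = a i"
      by auto
    then show "w \<in> apery n"
    proof cases
      case 1
      then show ?thesis
        using zero_in_H n_ge_2 by (auto simp: apery_def)
    next
      case 2
      \<comment> \<open>For \<open>h = 0\<close> this is \<open>n < a i\<close>; for
        \<open>h > 0\<close> equality would decompose the minimal generator
        \<open>a i\<close>.\<close>
      have "w \<noteq> n + h" if "h \<in> H" for h
        using a_irreducible[of i n h] n_in_H n_ge_2 2 that a_gt_n[of i] by (cases "h = 0") auto
      then show ?thesis
        using 2 a_in_H by (auto simp: apery_def)
    qed
  qed
  have inj: "inj_on a {2..n}"
    by (rule inj_on_subset[OF inj_on_a]) auto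
  have "0 \<notin> a ` {2..n}"
    using a_gt_n by fastforce
  then have "card ?W = n"
    using n_ge_2 by (simp add: card_image[OF inj])
  moreover have "inj_on (\<lambda>w. w mod n) ?W"
    by (rule inj_onI, rule apery_cong) (simp_all only: subsetD[OF W])
  ultimately have "card ((\<lambda>w. w mod n) ` ?W) = card {..<n}"
    by (simp only: card_image card_lessThan)
  moreover have "(\<lambda>w. w mod n) ` ?W \<subseteq> {..<n}"
    using n_ge_2 by auto
  ultimately have surj: "(\<lambda>w. w mod n) ` ?W = {..<n}"
    by (intro card_subset_eq) auto
  have "apery n \<subseteq> ?W"
  proof
    fix x assume x: "x \<in> apery n"
    have "x mod n \<in> (\<lambda>w. w mod n) ` ?W"
      using n_ge_2 unfolding surj by simp
    then obtain w where "w \<in> ?W" "x mod n = w mod n"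
      by (rule imageE)
    then show "x \<in> ?W"
      using apery_cong[OF x, of w] W by auto
  qed
  with W show eq: "apery n = ?W"
    by (rule subset_antisym[rotated])
  show "(\<lambda>w. w mod n) ` apery n = {..<n}"
    unfolding eq by (rule surj)
qed

text \<open>Otherwise the sum is a nonzero Apery element, hence a minimal generator, which does not
  decompose. For ideals: the square of the maximal ideal lies in \<open>t^n R\<close>.\<close>

lemma sum_in_shift:
  assumes "x \<in> H - {0}" "y \<in> H - {0}"
  shows "x + y \<in> (+) n ` H"
proof (rule ccontr)
  assume "x + y \<notin> (+) n ` H"
  then have "x + y \<in> apery n"
    using assms add_in_H by (auto simp: apery_def)
  then obtain i where "i \<in> {2..n}" "x + y = a i"
    using assms by (auto simp: apery_eq)
  then show False
    using assms a_irreducible[of i x y] by simp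
qed

text \<open>The Frobenius number is \<open>a n - n\<close>, the largest Apery element minus
  \<open>n\<close>; the right-hand side says that \<open>m\<close> exceeds it, avoiding truncated
  subtraction.\<close>

lemma above_conductor_iff: "{m..} \<subseteq> H \<longleftrightarrow> a n < m + n"
proof
  assume m: "{m..} \<subseteq> H"
  have "a n \<in> apery n"
    using n_ge_2 by (simp add: apery_eq)
  moreover have "a n = n + (a n - n)"
    using a_gt_n[of n] n_ge_2 by simp
  ultimately have "a n - n \<notin> H"
    by (metis DiffE apery_def image_eqI)
  then show "a n < m + n"
    using m by (metis atLeast_iff le_diff_conv2 a_gt_n le_refl less_imp_le n_ge_2 not_less subsetD)
next
  assume m: "a n < m + n"
  show "{m..} \<subseteq> H"
  proof
    fix k assume "k \<in> {m..}"
    then have large: "a n < k + n"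
      using m by simp
    have "k mod n \<in> (\<lambda>w. w mod n) ` apery n"
      using n_ge_2 by (simp add: apery_residues)
    then obtain w where w: "w \<in> apery n" "k mod n = w mod n"
      by (rule imageE)
    have "w \<le> a n"
      using w(1) a_le_a_n by (auto simp: apery_eq)
    \<comment> \<open>A positive difference \<open>w - k\<close> would be a multiple of
      \<open>n\<close>, hence at least \<open>n\<close>, against
      \<open>w \<le> a n < k + n\<close>.\<close>
    have "w \<le> k"
    proof (rule ccontr)
      assume "\<not> w \<le> k"
      then have "n dvd w - k" "0 < w - k"
        using w(2) by (auto simp: mod_eq_dvd_iff_nat[symmetric])
      then have "n \<le> w - k"
        by (rule dvd_imp_le)
      then show False
        using large \<open>w \<le> a n\<close> n_ge_2 by linarith
    qed
    then have "n dvd k - w"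
      using w(2) by (metis mod_eq_dvd_iff_nat)
    then obtain j where "k = w + n * j"
      using \<open>w \<le> k\<close> by (metis dvdE le_add_diff_inverse)
    then show "k \<in> H"
      using add_multiple_in_H w(1) by (simp add: apery_def)
  qed
qed

section \<open>The two types and the criteria\<close>

lemma reduced_type_a: "reduced_type R n = card {i \<in> {2..n}. a n < a i + n}"
proof -
  have inj: "inj_on a {i \<in> {2..n}. a n < a i + n}"
    by (rule inj_on_subset[OF inj_on_a]) auto
  \<comment> \<open>The Apery element \<open>0\<close> drops out because
    \<open>n < a n\<close>.\<close>
  have "{w \<in> apery n. {w..} \<subseteq> H} = a ` {i \<in> {2..n}. a n < a i + n}"
    using a_gt_n[of n] n_ge_2 by (auto simp: apery_eq above_conductor_iff)
  then show ?thesis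
    using reduced_type_eq[of n] n_in_H n_ge_2 card_image[OF inj] by simp
qed

text \<open>By \<open>sum_in_shift\<close> every nonzero Apery element gives a socle monomial. The
  element \<open>0\<close> does not: adding \<open>a 2\<close> stays in the Apery set.\<close>

lemma cm_type_a: "cm_type R n = n - 1"
proof -
  have "{w \<in> apery n. \<forall>y\<in>H - {0}. w + y \<in> (+) n ` H} = apery n - {0}"
  proof (rule equalityI; rule subsetI)
    fix w assume "w \<in> apery n - {0}"
    then show "w \<in> {w \<in> apery n. \<forall>y\<in>H - {0}. w + y \<in> (+) n ` H}"
      using sum_in_shift[of w] by (simp add: apery_def)
  next
    have "a 2 \<in> H - {0}" "a 2 \<in> apery n"
      using a_in_H[of 2] a_gt_n[of 2] n_ge_2 by (auto simp: apery_eq)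
    moreover fix w assume "w \<in> {w \<in> apery n. \<forall>y\<in>H - {0}. w + y \<in> (+) n ` H}"
    ultimately show "w \<in> apery n - {0}"
      by (auto simp: apery_def)
  qed
  also have "\<dots> = a ` {2..n}"
    using a_gt_n by (fastforce simp: apery_eq)
  finally show ?thesis
    using cm_type_eq[of n] n_in_H n_ge_2
    by (simp add: card_image[OF inj_on_subset[OF inj_on_a]])
qed

text \<open>The type is the size of \<open>{2..n}\<close>, and the reduced type counts some of these
  indices. Since \<open>a\<close> increases, all are counted as soon as \<open>2\<close> is.\<close>

lemma maximal_reduced_type_iff: "maximal_reduced_type R n \<longleftrightarrow> a n < a 2 + n"
proof -
  let ?S = "{i \<in> {2..n}. a n < a i + n}"
  have "card ?S = card {2..n} \<longleftrightarrow> ?S = {2..n}"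
    using card_subset_eq[of "{2..n}" ?S] by (metis (no_types, lifting) finite_atLeastAtMost mem_Collect_eq subsetI)
  also have "\<dots> \<longleftrightarrow> a n < a 2 + n"
  proof
    assume "a n < a 2 + n"
    moreover have "a 2 \<le> a i" if "i \<in> {2..n}" for i
      using a_mono[of 2 i] that by (cases "i = 2") auto
    ultimately show "?S = {2..n}"
      by force
  qed (use n_ge_2 in force)
  finally show ?thesis
    by (simp add: maximal_reduced_type_def reduced_type_a cm_type_a)
qed

text \<open>Index \<open>n\<close> is always counted, so reduced type \<open>1\<close> means that no
  other is. By monotonicity it suffices to test \<open>n - 1\<close>, provided that it is at least
  \<open>2\<close>.\<close>

lemma minimal_reduced_type_iff:
  assumes "H \<noteq> submonoid_generated {2, 3}"
  shows "minimal_reduced_type R n \<longleftrightarrow> a (n - 1) + n \<le> a n"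
\<comment> \<open>For \<open>n = 2\<close> the index \<open>n - 1\<close> falls outside the counted
  range. The reduced type is \<open>1\<close>, and the inequality reads \<open>4 \<le> a 2\<close>,
  which holds once \<open>a 2 = 3\<close> is excluded.\<close>
proof (cases "n = 2")
  case True
  have "a 2 \<noteq> 3"
  proof
    assume "a 2 = 3"
    have "{1..n} = {1, 2}"
      using True by auto
    then have "a ` {1..n} = {2, 3}"
      using True minimal_multiplicity \<open>a 2 = 3\<close> by simp
    then show False
      using assms H_eq by simp
  qed
  moreover have "a 2 \<noteq> 4"
    using a_irreducible[of 2 2 2] n_in_H True by simp
  ultimately have "a (n - 1) + n \<le> a n"
    using True minimal_multiplicity a_gt_n[of 2] by simp
  moreover have "{i \<in> {2..n}. a n < a i + n} = {2}"
    using True by auto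
  then have "minimal_reduced_type R n"
    unfolding minimal_reduced_type_def reduced_type_a by simp
  ultimately show ?thesis
    by simp
next
  case False
  then have n: "3 \<le> n"
    using n_ge_2 by simp
  let ?S = "{i \<in> {2..n}. a n < a i + n}"
  have "n \<in> ?S"
    using n by simp
  have singleton: "card S = 1 \<longleftrightarrow> S = {n}" if "n \<in> S" for S
    using that by (auto simp: card_1_singleton_iff)
  have "card ?S = 1 \<longleftrightarrow> ?S = {n}"
    by (rule singleton) fact
  also have "\<dots> \<longleftrightarrow> a (n - 1) + n \<le> a n"
  proof
    assume S: "?S = {n}"
    have "n - 1 \<notin> ?S"
      unfolding S using n by simp
    then show "a (n - 1) + n \<le> a n"
      using n by auto
  next
    assume le: "a (n - 1) + n \<le> a n"
    have "i = n" if i: "i \<in> ?S" for i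
    proof (rule ccontr)
      assume "i \<noteq> n"
      then consider "i = n - 1" | "i < n - 1"
        using i by fastforce
      then have "a i \<le> a (n - 1)"
        using i a_mono[of i "n - 1"] by cases auto
      with le i show False
        by simp
    qed
    with \<open>n \<in> ?S\<close> show "?S = {n}"
      by blast
  qed
  finally show ?thesis
    by (simp add: minimal_reduced_type_def reduced_type_a)
qed

end

theorem theorem2:
  fixes H :: "nat set" and n :: nat and a :: "nat \<Rightarrow> nat"
    and R :: "'k::{alg_closed_field, field_char_0} fls ring"
  assumes semigroup: "numerical_semigroup H"
    and non_regular: "H \<noteq> UNIV"
    and increasing: "strict_mono_on {1..n} a"
    and generators: "minimally_generates (a ` {1..n}) H"
    and ring: "R = semigroup_ring H"
    and minimal_multiplicity: "a 1 = n"
  shows "(maximal_reduced_type R (a 1) \<longleftrightarrow> int (a 2) \<ge> int (a n) - int (a 1) + 1) \<and>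
         (H \<noteq> submonoid_generated {2, 3} \<longrightarrow>
           (minimal_reduced_type R (a 1) \<longleftrightarrow> int (a (n - 1)) + int (a 1) - 1 < int (a n)))"
proof -
  interpret minimal_multiplicity_semigroup_ring H R n a
    by unfold_locales (use assms in auto)
  show ?thesis
    \<comment> \<open>Over the integers the subtractions are exact, and \<open>x - 1 < y\<close> is
      \<open>x \<le> y\<close>, so both criteria match the forms over the naturals.\<close>
    unfolding minimal_multiplicity maximal_reduced_type_iff
    by (intro conjI impI; (subst minimal_reduced_type_iff, assumption)?; linarith)
qed

end
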